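(* Let $(A, \cdot, P_{\Omega})$ be an associative matching Rota-Baxter algebra of weight $\lambda_\Omega$. For $p \in Cent(A)$ and $x, y \in A$, define $$x \cdot_p^1 y :=p(x) \cdot y \quad \text{and} \quad x \cdot_p^2 y := p(x) \cdot p(y).$$ If $p \circ P_{\omega} =P_{\omega} \circ p$ for all $\omega \in \Omega$, then $(A, \cdot_p^1, P_{\Omega}, p)$ and $(A, \cdot_p^2, P_{\Omega}, p)$ are matching Hom-associative Rota-Baxter algebras of weight $\lambda_\Omega$.
   Context: Let $\mathbf{k}$ be a unitary commutative ring, the base ring of all modules, algebras and linear maps, and let $\Omega$ be a nonempty set. Let $\lambda_{\Omega}=(\lambda_{\omega})_{\omega\in \Omega}$ be a family of scalars in $\mathbf{k}$. An (associative) matching Rota-Baxter algebra of weight $\lambda_{\Omega}$ is an associative algebra $(A,\cdot)$ equipped with a family $P_\Omega=(P_\omega)_{\omega\in \Omega}$ of linear operators $P_\omega: A\to A$ satisfying the matching Rota-Baxter equation $$P_{\alpha}(x) \cdot P_{\beta}(y)=P_{\alpha}(x \cdot P_{\beta}(y))+P_{\beta}(P_{\alpha}(x) \cdot y)+ \lambda_{\beta}P_{\alpha}(x \cdot y)\quad\text{for all } x,y \in A,\ \alpha, \beta \in \Omega.$$ The centroid of an associative algebra $(A,\cdot)$ is $Cent(A):=\{p\in End(A) \mid p(x\cdot y)=p(x)\cdot y=x\cdot p(y) \text{ for all } x,y\in A\}$, where $End(A)$ is the set of linear maps $A\to A$. A Hom-associative algebra is a triple $(A,\cdot,p)$ with $A$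 a $\mathbf{k}$-module, $\cdot:A\otimes A\to A$ bilinear and $p:A\to A$ linear, such that $(x\cdot y)\cdot p(z)=p(x)\cdot(y\cdot z)$ for all $x,y,z\in A$. A matching Hom-associative Rota-Baxter algebra of weight $\lambda_\Omega$ is a quadruple $(A,\cdot,P_\Omega,p)$ where $(A,\cdot,p)$ is a Hom-associative algebra and $P_\Omega$ is a family of linear operators on $A$ satisfying the matching Rota-Baxter equation of weight $\lambda_\Omega$ with respect to $\cdot$. *)

theory Defs
  imports "HOL-Algebra.Module"
begin

text \<open>
  HOL-Algebra's \<open>algebra\<close> requires the algebra itself to be a commutative unital ring, so the
  (non-unital, non-commutative) algebras here are a module together with a separate product
  \<open>mul\<close>. The fields \<open>mult\<close> and \<open>one\<close> that the module record inherits from the ring record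
  are never used. All laws concern elements of the carrier only; the values of \<open>mul\<close> and of
  the operators outside the carrier are irrelevant.
\<close>

definition linear_endos :: "('k, 'm) ring_scheme \<Rightarrow> ('k, 'a, 'n) module_scheme \<Rightarrow> ('a \<Rightarrow> 'a) set"
  where
  "linear_endos R A =
    {f \<in> carrier A \<rightarrow> carrier A.
      (\<forall>x\<in>carrier A. \<forall>y\<in>carrier A. f (x \<oplus>\<^bsub>A\<^esub> y) = f x \<oplus>\<^bsub>A\<^esub> f y) \<and>
      (\<forall>c\<in>carrier R. \<forall>x\<in>carrier A. f (c \<odot>\<^bsub>A\<^esub> x) = c \<odot>\<^bsub>A\<^esub> f x)}"

locale bilinear_algebra = module R A
  for R :: "('k, 'm) ring_scheme" and A :: "('k, 'a, 'n) module_scheme" +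
  fixes mul :: "'a \<Rightarrow> 'a \<Rightarrow> 'a"
  assumes mul_linear_left: "y \<in> carrier A \<Longrightarrow> (\<lambda>x. mul x y) \<in> linear_endos R A"
    and mul_linear_right: "x \<in> carrier A \<Longrightarrow> (\<lambda>y. mul x y) \<in> linear_endos R A"

locale associative_algebra = bilinear_algebra R A mul
  for R :: "('k, 'm) ring_scheme" and A :: "('k, 'a, 'n) module_scheme"
    and mul :: "'a \<Rightarrow> 'a \<Rightarrow> 'a" +
  assumes mul_assoc:
    "x \<in> carrier A \<Longrightarrow> y \<in> carrier A \<Longrightarrow> z \<in> carrier A \<Longrightarrow>
      mul (mul x y) z = mul x (mul y z)"

locale hom_associative_algebra = bilinear_algebra R A mul
  for R :: "('k, 'm) ring_scheme" and A :: "('k, 'a, 'n) module_scheme"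
    and mul :: "'a \<Rightarrow> 'a \<Rightarrow> 'a" +
  fixes p :: "'a \<Rightarrow> 'a"
  assumes p_linear: "p \<in> linear_endos R A"
    and hom_assoc:
      "x \<in> carrier A \<Longrightarrow> y \<in> carrier A \<Longrightarrow> z \<in> carrier A \<Longrightarrow>
        mul (mul x y) (p z) = mul (p x) (mul y z)"

locale matching_rota_baxter = bilinear_algebra R A mul
  for R :: "('k, 'm) ring_scheme" and A :: "('k, 'a, 'n) module_scheme"
    and mul :: "'a \<Rightarrow> 'a \<Rightarrow> 'a" +
  fixes \<Omega> :: "'i set" and lam :: "'i \<Rightarrow> 'k" and P :: "'i \<Rightarrow> 'a \<Rightarrow> 'a"
  assumes index_nonempty: "\<Omega> \<noteq> {}"
    and weight_closed: "\<omega> \<in> \<Omega> \<Longrightarrow> lam \<omega> \<in> carrier R"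
    and P_linear: "\<omega> \<in> \<Omega> \<Longrightarrow> P \<omega> \<in> linear_endos R A"
    and matching_rota_baxter_eq:
      "\<alpha> \<in> \<Omega> \<Longrightarrow> \<beta> \<in> \<Omega> \<Longrightarrow> x \<in> carrier A \<Longrightarrow> y \<in> carrier A \<Longrightarrow>
        mul (P \<alpha> x) (P \<beta> y) =
          P \<alpha> (mul x (P \<beta> y)) \<oplus>\<^bsub>A\<^esub> P \<beta> (mul (P \<alpha> x) y) \<oplus>\<^bsub>A\<^esub> lam \<beta> \<odot>\<^bsub>A\<^esub> P \<alpha> (mul x y)"

locale associative_matching_rota_baxter_algebra =
  associative_algebra R A mul + matching_rota_baxter R A mul \<Omega> lam P
  for R A mul \<Omega> lam P

locale hom_associative_matching_rota_baxter_algebra =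
  hom_associative_algebra R A mul p + matching_rota_baxter R A mul \<Omega> lam P
  for R A mul \<Omega> lam P p

definition centroid ::
  "('k, 'm) ring_scheme \<Rightarrow> ('k, 'a, 'n) module_scheme \<Rightarrow> ('a \<Rightarrow> 'a \<Rightarrow> 'a) \<Rightarrow> ('a \<Rightarrow> 'a) set"
  where
  "centroid R A mul =
    {p \<in> linear_endos R A.
      \<forall>x\<in>carrier A. \<forall>y\<in>carrier A.
        p (mul x y) = mul (p x) y \<and> mul (p x) y = mul x (p y)}"

definition twist1 :: "('a \<Rightarrow> 'a \<Rightarrow> 'a) \<Rightarrow> ('a \<Rightarrow> 'a) \<Rightarrow> 'a \<Rightarrow> 'a \<Rightarrow> 'a"
  where "twist1 mul p x y = mul (p x) y"

definition twist2 :: "('a \<Rightarrow> 'a \<Rightarrow> 'a) \<Rightarrow> ('a \<Rightarrow> 'a) \<Rightarrow> 'a \<Rightarrow> 'a \<Rightarrow> 'a"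
  where "twist2 mul p x y = mul (p x) (p y)"

end

theory Submission
  imports Defs
begin

text \<open>
  Both twisted products have the form \<open>mul (f x) (g y)\<close> with \<open>f\<close> and \<open>g\<close> linear: take
  \<open>(f, g) = (p, id)\<close> for the first and \<open>(f, g) = (p, p)\<close> for the second. If \<open>f\<close> and \<open>g\<close> commute
  with every \<open>P \<omega>\<close>, then the matching Rota-Baxter equation for such a product at \<open>x\<close>, \<open>y\<close> is
  the original equation at \<open>f x\<close>, \<open>g y\<close>, so it holds for both twists at once
  (\<open>matching_rota_baxter_twist\<close>).

  Hom-associativity does not involve the operators: an element of the centroid can be moved
  from any factor of a product to any other, so that both sides of the Hom-associative law become
  associated forms of one triple product, in which \<open>p\<close> occurs three times for the first twist and
  five times for the second.
\<close>

lemma linear_endos_closed: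
  "f \<in> linear_endos R A \<Longrightarrow> x \<in> carrier A \<Longrightarrow> f x \<in> carrier A"
  by (auto simp: linear_endos_def)

lemma linear_endos_comp:
  assumes "f \<in> linear_endos R A" and "g \<in> linear_endos R A"
  shows "(\<lambda>x. f (g x)) \<in> linear_endos R A"
  using assms by (auto simp: linear_endos_def Pi_iff)

lemma linear_endos_ident: "(\<lambda>x. x) \<in> linear_endos R A"
  by (simp add: linear_endos_def)

lemma (in bilinear_algebra) mul_closed:
  "x \<in> carrier A \<Longrightarrow> y \<in> carrier A \<Longrightarrow> mul x y \<in> carrier A"
  using linear_endos_closed[OF mul_linear_right] .

lemma (in bilinear_algebra) bilinear_algebra_twist:
  assumes f: "f \<in> linear_endos R A" and g: "g \<in> linear_endos R A"
  shows "bilinear_algebra R A (\<lambda>x y. mul (f x) (g y))"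
proof (intro bilinear_algebra.intro bilinear_algebra_axioms.intro module_axioms)
  fix z assume z: "z \<in> carrier A"
  show "(\<lambda>x. mul (f x) (g z)) \<in> linear_endos R A"
    using linear_endos_comp[OF mul_linear_left f] linear_endos_closed[OF g z] by blast
  show "(\<lambda>y. mul (f z) (g y)) \<in> linear_endos R A"
    using linear_endos_comp[OF mul_linear_right g] linear_endos_closed[OF f z] by blast
qed

text \<open>
  In each term of the equation, \<open>f\<close> and \<open>g\<close> act on a single factor of a product, where they
  meet at most one operator: \<open>P \<alpha>\<close> in the left factor, \<open>P \<beta>\<close> in the right one. Operators
  applied to a whole product stay outside. Commuting \<open>f\<close> and \<open>g\<close> inwards therefore leaves the
  untwisted equation at \<open>f x\<close> and \<open>g y\<close>.
\<close>

lemma (in matching_rota_baxter) matching_rota_baxter_twist: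
  assumes f: "f \<in> linear_endos R A" and g: "g \<in> linear_endos R A"
    and fP: "\<And>\<omega> x. \<omega> \<in> \<Omega> \<Longrightarrow> x \<in> carrier A \<Longrightarrow> f (P \<omega> x) = P \<omega> (f x)"
    and gP: "\<And>\<omega> x. \<omega> \<in> \<Omega> \<Longrightarrow> x \<in> carrier A \<Longrightarrow> g (P \<omega> x) = P \<omega> (g x)"
  shows "matching_rota_baxter R A (\<lambda>x y. mul (f x) (g y)) \<Omega> lam P"
proof (intro matching_rota_baxter.intro matching_rota_baxter_axioms.intro
    bilinear_algebra_twist f g index_nonempty weight_closed P_linear)
  fix \<alpha> \<beta> x y
  assume "\<alpha> \<in> \<Omega>" "\<beta> \<in> \<Omega>" "x \<in> carrier A" "y \<in> carrier A"
  then show "mul (f (P \<alpha> x)) (g (P \<beta> y)) =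
      P \<alpha> (mul (f x) (g (P \<beta> y))) \<oplus>\<^bsub>A\<^esub> P \<beta> (mul (f (P \<alpha> x)) (g y))
        \<oplus>\<^bsub>A\<^esub> lam \<beta> \<odot>\<^bsub>A\<^esub> P \<alpha> (mul (f x) (g y))"
    using matching_rota_baxter_eq[of \<alpha> \<beta> "f x" "g y"]
    by (simp add: fP gP linear_endos_closed[OF f] linear_endos_closed[OF g])
qed

lemma centroid_linear: "p \<in> centroid R A mul \<Longrightarrow> p \<in> linear_endos R A"
  by (simp add: centroid_def)

lemma centroid_mul_left:
  "p \<in> centroid R A mul \<Longrightarrow> x \<in> carrier A \<Longrightarrow> y \<in> carrier A \<Longrightarrow>
    p (mul x y) = mul (p x) y"
  by (simp add: centroid_def)

lemma centroid_mul_right: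
  "p \<in> centroid R A mul \<Longrightarrow> x \<in> carrier A \<Longrightarrow> y \<in> carrier A \<Longrightarrow>
    p (mul x y) = mul x (p y)"
  by (simp add: centroid_def)

lemma (in associative_algebra) hom_associative_algebra_twist1:
  assumes p: "p \<in> centroid R A mul"
  shows "hom_associative_algebra R A (twist1 mul p) p"
proof (intro hom_associative_algebra.intro hom_associative_algebra_axioms.intro)
  note lin = centroid_linear[OF p]
  note closed = linear_endos_closed[OF lin] mul_closed
  show "bilinear_algebra R A (twist1 mul p)"
    using bilinear_algebra_twist[OF lin linear_endos_ident] by (simp add: twist1_def[abs_def])
  show "p \<in> linear_endos R A" by (fact lin)
  fix x y z
  assume xyz: "x \<in> carrier A" "y \<in> carrier A" "z \<in> carrier A"
  have "mul (p (mul (p x) y)) (p z) = mul (p (p x)) (mul y (p z))"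
    by (simp add: xyz closed centroid_mul_left[OF p] mul_assoc)
  also have "mul y (p z) = mul (p y) z"
    using xyz centroid_mul_left[OF p] centroid_mul_right[OF p] by metis
  finally show "twist1 mul p (twist1 mul p x y) (p z) = twist1 mul p (p x) (twist1 mul p y z)"
    by (simp add: twist1_def)
qed

lemma (in associative_algebra) hom_associative_algebra_twist2:
  assumes p: "p \<in> centroid R A mul"
  shows "hom_associative_algebra R A (twist2 mul p) p"
proof (intro hom_associative_algebra.intro hom_associative_algebra_axioms.intro)
  note lin = centroid_linear[OF p]
  note closed = linear_endos_closed[OF lin] mul_closed
  show "bilinear_algebra R A (twist2 mul p)"
    using bilinear_algebra_twist[OF lin lin] by (simp add: twist2_def[abs_def])
  show "p \<in> linear_endos R A" by (fact lin)
  fix x y z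
  assume xyz: "x \<in> carrier A" "y \<in> carrier A" "z \<in> carrier A"
  have "mul (p (mul (p x) (p y))) (p (p z)) = mul (p (p x)) (mul (p y) (p (p z)))"
    by (simp add: xyz closed centroid_mul_left[OF p] mul_assoc)
  also have "mul (p y) (p (p z)) = p (mul (p y) (p z))"
    by (simp add: xyz closed centroid_mul_right[OF p])
  finally show "twist2 mul p (twist2 mul p x y) (p z) = twist2 mul p (p x) (twist2 mul p y z)"
    by (simp add: twist2_def)
qed

theorem proposition3p7:
  fixes R :: "('k, 'm) ring_scheme" and A :: "('k, 'a, 'n) module_scheme"
    and mul :: "'a \<Rightarrow> 'a \<Rightarrow> 'a"
    and \<Omega> :: "'i set" and lam :: "'i \<Rightarrow> 'k" and P :: "'i \<Rightarrow> 'a \<Rightarrow> 'a" and p :: "'a \<Rightarrow> 'a"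
  assumes "associative_matching_rota_baxter_algebra R A mul \<Omega> lam P"
    and "p \<in> centroid R A mul"
    and "\<And>\<omega> x. \<omega> \<in> \<Omega> \<Longrightarrow> x \<in> carrier A \<Longrightarrow> p (P \<omega> x) = P \<omega> (p x)"
  shows "hom_associative_matching_rota_baxter_algebra R A (twist1 mul p) \<Omega> lam P p \<and>
    hom_associative_matching_rota_baxter_algebra R A (twist2 mul p) \<Omega> lam P p"
proof -
  interpret associative_matching_rota_baxter_algebra R A mul \<Omega> lam P by fact
  note lin = centroid_linear[OF assms(2)]
  have "matching_rota_baxter R A (twist1 mul p) \<Omega> lam P"
    using matching_rota_baxter_twist[OF lin linear_endos_ident assms(3) refl]
    by (simp add: twist1_def[abs_def])
  moreover have "matching_rota_baxter R A (twist2 mul p) \<Omega> lam P"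
    using matching_rota_baxter_twist[OF lin lin assms(3) assms(3)]
    by (simp add: twist2_def[abs_def])
  ultimately show ?thesis
    by (simp add: hom_associative_matching_rota_baxter_algebra.intro
        hom_associative_algebra_twist1[OF assms(2)] hom_associative_algebra_twist2[OF assms(2)])
qed

end
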